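(* Let $\lambda_0\in[s_1,s_2]$, $x_0\in\mathbb R^d$, $a\in\mathbb R^d$, and let $v(\lambda,x)=K_{\mathbb W}((\lambda,x),(\lambda_0,x_0))a$, where $K_{\mathbb W}$ is the reproducing kernel of $\mathbb W$. Then: (i) for every $\lambda\in(s_1,s_2]$, as an identity between linear forms on $W_\lambda$, $$\int_{[s_1,\lambda]}(\lambda-\mu)\,\mathbf L_\mu v(\mu)\,d\rho(\mu)-\int_{s_1}^{\lambda}\mathbf L_\mu\partial_\lambda v(\mu)\,d\mu=(\lambda-\lambda_0)\mathbf 1_{[s_1,\lambda]}(\lambda_0)\,a^T\delta_{x_0},$$ that is, for every $\bar w\in W_\lambda$, $$\int_{[s_1,\lambda]}(\lambda-\mu)\langle v(\mu),\bar w\rangle_\mu\,d\rho(\mu)-\int_{s_1}^{\lambda}\langle\partial_\lambda v(\mu),\bar w\rangle_\mu\,d\mu=(\lambda-\lambda_0)\mathbf 1_{[s_1,\lambda]}(\lambda_0)\,a^T\bar w(x_0);$$ (ii) as an identity between linear forms on $W_{s_2}$, $$\int_{[s_1,s_2]}\mathbf L_\mu v(\mu)\,d\rho(\mu)=a^T\delta_{x_0},$$ that is, $\int_{[s_1,s_2]}\langle v(\mu),\bar w\rangle_\mu\,d\rho(\mu)=a^T\bar w(x_0)$ for every $\bar w\in W_{s_2}$.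
   Context: Let $0<s_1<s_2$ and $d\ge 1$. Let $V$ be a reproducing kernel Hilbert space (RKHS) of vector fields on $\mathbb R^d$, continuously embedded in $C^1_0(\mathbb R^d)$, the space of $C^1$ vector fields $v:\mathbb R^d\to\mathbb R^d$ such that $v$ and $Dv$ tend to $0$ at infinity, with norm $\|\cdot\|_{1,\infty}$. $\mathbb V=H^1((s_1,s_2),V)$ is the Hilbert space of square-integrable $v:(s_1,s_2)\to V$ with square-integrable weak derivative $\partial_\lambda v$ (Bochner sense). Each $v\in\mathbb V$ is identified with its continuous version $[s_1,s_2]\to V$; write $v(\lambda,x)=v(\lambda)(x)$. Nested family: set $W_0=V$ and let $(W_\lambda)_{\lambda\in[s_1,s_2]}$ be RKHS's of vector fields on $\mathbb R^d$ with Hilbert norms $\|\cdot\|_\lambda$ and inner products $\langle\cdot,\cdot\rangle_\lambda$ (with $\|\cdot\|_0=\|\cdot\|_V$), such that $W_\lambda\subset W_\mu$ with continuous inclusion for all $\lambda,\mu\in\{0\}\cup[s_1,s_2]$ with $\mu<\lambda$. Let $c_{\lambda,\mu}$ be the operator norm of this inclusion; it is assumed that $C:=\sup\{c_{\lambda,\mu}:\mu,\lambda\in\{0\}\cup[s_1,s_2],\ \mu<\lambda\}<\infty$. Let $\rho$ be a finite nonzero positive Borel measure on $[s_1,s_2]$. $\mathbb W$ is the subspace of all $v\in\mathbb V$ such that $v(\lambda)\in W_\lambda$ for $\rho$-a.e. $\lambda$, $\partial_\lambda v(\lambda)\in W_\lambda$ for Lebesgue-a.e. $\lambda$, and $\|v\|_{\mathbb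 W}^2:=\int_{[s_1,s_2]}\|v(\lambda)\|_\lambda^2d\rho(\lambda)+\int_{s_1}^{s_2}\|\partial_\lambda v(\lambda)\|_\lambda^2d\lambda<\infty$. As implicit in this definition, $\lambda\mapsto\|u(\lambda)\|_\lambda\in[0,\infty]$ (equal to $+\infty$ if $u(\lambda)\notin W_\lambda$) is assumed measurable for every strongly Borel measurable $u:[s_1,s_2]\to V$. The space $\mathbb W$ is an RKHS over $[s_1,s_2]\times\mathbb R^d$; its reproducing kernel $K_{\mathbb W}$ is the $d\times d$-matrix-valued function such that $K_{\mathbb W}(\cdot,(\lambda_0,x_0))a\in\mathbb W$ and $\langle K_{\mathbb W}(\cdot,(\lambda_0,x_0))a,w\rangle_{\mathbb W}=a^Tw(\lambda_0,x_0)$ for all $w\in\mathbb W$, $a\in\mathbb R^d$. $\mathbf L_\mu:W_\mu\to W_\mu^*$ is the duality operator, $(\mathbf L_\mu h\mid h')=\langle h,h'\rangle_\mu$; for $\mu\le\lambda$ elements of $W_\mu^*$ are regarded as elements of $W_\lambda^*$ by restriction. $a^T\delta_{x_0}$ is the linear form $w\mapsto a^Tw(x_0)$. Integrals of linear forms are understood by testing on vectors. $\mathbf 1_A$ is the indicator function of $A$. *)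

theory Defs
  imports "HOL-Analysis.Analysis"
begin

text \<open>
  The Hilbert space \<open>V\<close> of vector fields is the type \<open>'v\<close>, together with the evaluation map
  \<open>ev :: 'v \<Rightarrow> (real^'d \<Rightarrow> real^'d)\<close>, which is linear and injective and so identifies the elements
  of \<open>'v\<close> with vector fields.  The spaces \<open>W \<lambda>\<close> are all contained in \<open>V\<close>, hence they are subsets
  of \<open>'v\<close>; their inner products are \<open>ip \<lambda>\<close>, whose values off \<open>W \<lambda>\<close> are irrelevant.

  The library's Bochner integral requires the class \<open>second_countable_topology\<close>.  This is no
  restriction for a Hilbert space that is continuously embedded in the continuous fields:
  the Riesz representers of \<open>h \<mapsto> ev h x $ i\<close>, with \<open>x\<close> in a countable dense subset of \<open>real^'d\<close>,
  are countably many, and only \<open>0\<close> is orthogonal to all of them, so \<open>V\<close> is separable.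
  In particular Borel measurability and strong measurability coincide for \<open>'v\<close>-valued maps.
\<close>

section \<open>The space of fields that vanish at infinity with their derivative\<close>

definition C1_0 :: "(real^'d \<Rightarrow> real^'d) set" where
  "C1_0 = {f. (\<forall>x. f differentiable (at x)) \<and>
     continuous_on UNIV (\<lambda>x. Blinfun (frechet_derivative f (at x))) \<and>
     (f \<longlongrightarrow> 0) at_infinity \<and>
     ((\<lambda>x. Blinfun (frechet_derivative f (at x))) \<longlongrightarrow> 0) at_infinity}"

definition norm_1_inf :: "(real^'d \<Rightarrow> real^'d) \<Rightarrow> real" where
  "norm_1_inf f = (SUP x. norm (f x)) + (SUP x. onorm (frechet_derivative f (at x)))"

definition cont_embedded_C1_0 :: "('v::real_normed_vector \<Rightarrow> real^'d \<Rightarrow> real^'d) \<Rightarrow> bool" where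
  "cont_embedded_C1_0 ev \<longleftrightarrow>
     (\<forall>h. ev h \<in> C1_0) \<and> (\<exists>c. \<forall>h. norm_1_inf (ev h) \<le> c * norm h)"

section \<open>Reproducing kernel Hilbert spaces of vector fields\<close>

definition field_space :: "('v::real_vector \<Rightarrow> real^'d \<Rightarrow> real^'d) \<Rightarrow> bool" where
  "field_space ev \<longleftrightarrow> (\<forall>x. linear (\<lambda>h. ev h x)) \<and> inj ev"

definition ip_norm :: "('v \<Rightarrow> 'v \<Rightarrow> real) \<Rightarrow> 'v \<Rightarrow> real" where
  "ip_norm b h = sqrt (b h h)"

definition inner_product_on :: "'v::real_vector set \<Rightarrow> ('v \<Rightarrow> 'v \<Rightarrow> real) \<Rightarrow> bool" where
  "inner_product_on S b \<longleftrightarrow>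
     (\<forall>h\<in>S. \<forall>k\<in>S. b h k = b k h) \<and>
     (\<forall>h\<in>S. \<forall>k\<in>S. \<forall>l\<in>S. b (h + k) l = b h l + b k l) \<and>
     (\<forall>h\<in>S. \<forall>k\<in>S. \<forall>r. b (r *\<^sub>R h) k = r * b h k) \<and>
     (\<forall>h\<in>S. h \<noteq> 0 \<longrightarrow> b h h > 0)"

definition complete_ip_on :: "'v::real_vector set \<Rightarrow> ('v \<Rightarrow> 'v \<Rightarrow> real) \<Rightarrow> bool" where
  "complete_ip_on S b \<longleftrightarrow>
     (\<forall>X :: nat \<Rightarrow> 'v. (\<forall>n. X n \<in> S) \<longrightarrow>
        (\<forall>e>0. \<exists>N. \<forall>m\<ge>N. \<forall>n\<ge>N. ip_norm b (X m - X n) < e) \<longrightarrow>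
        (\<exists>l\<in>S. (\<lambda>n. ip_norm b (X n - l)) \<longlonglongrightarrow> 0))"

definition rkhs_on ::
  "('v::real_vector \<Rightarrow> real^'d \<Rightarrow> real^'d) \<Rightarrow> 'v set \<Rightarrow> ('v \<Rightarrow> 'v \<Rightarrow> real) \<Rightarrow> bool" where
  "rkhs_on ev S b \<longleftrightarrow> subspace S \<and> inner_product_on S b \<and> complete_ip_on S b \<and>
     (\<forall>x. \<exists>c. \<forall>h\<in>S. norm (ev h x) \<le> c * ip_norm b h)"

section \<open>The nested family\<close>

definition scales :: "real \<Rightarrow> real \<Rightarrow> real set" where
  "scales s1 s2 = {0} \<union> {s1..s2}"

definition cont_inclusion ::
  "(real \<Rightarrow> 'v set) \<Rightarrow> (real \<Rightarrow> 'v \<Rightarrow> 'v \<Rightarrow> real) \<Rightarrow> real \<Rightarrow> real \<Rightarrow> bool" where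
  "cont_inclusion W ip l m \<longleftrightarrow> W l \<subseteq> W m \<and>
     (\<exists>c. \<forall>h\<in>W l. ip_norm (ip m) h \<le> c * ip_norm (ip l) h)"

definition incl_norm ::
  "(real \<Rightarrow> 'v set) \<Rightarrow> (real \<Rightarrow> 'v \<Rightarrow> 'v \<Rightarrow> real) \<Rightarrow> real \<Rightarrow> real \<Rightarrow> real" where
  "incl_norm W ip l m = Sup {ip_norm (ip m) h |h. h \<in> W l \<and> ip_norm (ip l) h \<le> 1}"

definition nested_family ::
  "real \<Rightarrow> real \<Rightarrow> ('v::real_inner \<Rightarrow> real^'d \<Rightarrow> real^'d) \<Rightarrow> (real \<Rightarrow> 'v set) \<Rightarrow>
   (real \<Rightarrow> 'v \<Rightarrow> 'v \<Rightarrow> real) \<Rightarrow> bool" where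
  "nested_family s1 s2 ev W ip \<longleftrightarrow>
     W 0 = UNIV \<and> ip 0 = (\<bullet>) \<and>
     (\<forall>l\<in>scales s1 s2. rkhs_on ev (W l) (ip l)) \<and>
     (\<forall>l\<in>scales s1 s2. \<forall>m\<in>scales s1 s2. m < l \<longrightarrow> cont_inclusion W ip l m) \<and>
     bdd_above {incl_norm W ip l m |l m. l \<in> scales s1 s2 \<and> m \<in> scales s1 s2 \<and> m < l}"

definition enorm_at ::
  "(real \<Rightarrow> 'v set) \<Rightarrow> (real \<Rightarrow> 'v \<Rightarrow> 'v \<Rightarrow> real) \<Rightarrow> real \<Rightarrow> 'v \<Rightarrow> ennreal" where
  "enorm_at W ip l h = (if h \<in> W l then ennreal (ip_norm (ip l) h) else \<infinity>)"

definition measurable_norms ::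
  "real \<Rightarrow> real \<Rightarrow> (real \<Rightarrow> 'v::topological_space set) \<Rightarrow> (real \<Rightarrow> 'v \<Rightarrow> 'v \<Rightarrow> real) \<Rightarrow> bool" where
  "measurable_norms s1 s2 W ip \<longleftrightarrow>
     (\<forall>u \<in> borel_measurable (restrict_space borel {s1..s2}).
        (\<lambda>l. enorm_at W ip l (u l)) \<in> borel_measurable (restrict_space borel {s1..s2}))"

text \<open>
  \<open>dualop W ip m h k\<close> is \<open>(L\<^sub>m h | k)\<close>.  The value \<open>0\<close> off \<open>W m\<close> only matters for integrands
  \<open>m \<mapsto> (L\<^sub>m u(m) | k)\<close> with \<open>u(m) \<in> W m\<close> for almost every \<open>m\<close>: a fixed value on the exceptional
  null set keeps them Borel measurable.
\<close>

definition dualop ::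
  "(real \<Rightarrow> 'v set) \<Rightarrow> (real \<Rightarrow> 'v \<Rightarrow> 'v \<Rightarrow> real) \<Rightarrow> real \<Rightarrow> 'v \<Rightarrow> 'v \<Rightarrow> real" where
  "dualop W ip m h k = (if h \<in> W m \<and> k \<in> W m then ip m h k else 0)"

section \<open>Weak derivatives and the Sobolev space of \<open>V\<close>-valued maps\<close>

definition test_function :: "real \<Rightarrow> real \<Rightarrow> (real \<Rightarrow> real) \<Rightarrow> bool" where
  "test_function s1 s2 \<phi> \<longleftrightarrow>
     (\<forall>n t. (deriv ^^ n) \<phi> field_differentiable (at t)) \<and>
     (\<exists>a b. s1 < a \<and> b < s2 \<and> (\<forall>t. t \<notin> {a..b} \<longrightarrow> \<phi> t = 0))"

definition square_integrable ::
  "real \<Rightarrow> real \<Rightarrow> (real \<Rightarrow> 'v::{real_inner,banach,second_countable_topology}) \<Rightarrow> bool" where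
  "square_integrable s1 s2 u \<longleftrightarrow>
     set_borel_measurable borel {s1<..<s2} u \<and>
     set_integrable lborel {s1<..<s2} (\<lambda>t. (norm (u t))\<^sup>2)"

definition has_weak_derivative ::
  "real \<Rightarrow> real \<Rightarrow> (real \<Rightarrow> 'v::{real_inner,banach,second_countable_topology}) \<Rightarrow> (real \<Rightarrow> 'v) \<Rightarrow> bool"
  where
  "has_weak_derivative s1 s2 v dv \<longleftrightarrow>
     square_integrable s1 s2 v \<and> square_integrable s1 s2 dv \<and>
     (\<forall>\<phi>. test_function s1 s2 \<phi> \<longrightarrow>
        set_lebesgue_integral lborel {s1<..<s2} (\<lambda>t. deriv \<phi> t *\<^sub>R v t) =
        - set_lebesgue_integral lborel {s1<..<s2} (\<lambda>t. \<phi> t *\<^sub>R dv t))"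

text \<open>A Borel representative of the weak derivative, which is unique almost everywhere.\<close>

definition weak_deriv ::
  "real \<Rightarrow> real \<Rightarrow> (real \<Rightarrow> 'v::{real_inner,banach,second_countable_topology}) \<Rightarrow> real \<Rightarrow> 'v" where
  "weak_deriv s1 s2 v = (SOME dv. has_weak_derivative s1 s2 v dv)"

text \<open>
  Elements of \<open>H1\<close> are continuous versions on \<open>{s1..s2}\<close>; their values elsewhere are irrelevant.
\<close>

definition H1 ::
  "real \<Rightarrow> real \<Rightarrow> (real \<Rightarrow> 'v::{real_inner,banach,second_countable_topology}) set" where
  "H1 s1 s2 = {v. continuous_on {s1..s2} v \<and> (\<exists>dv. has_weak_derivative s1 s2 v dv)}"

section \<open>The multiscale space and its reproducing kernel\<close>

definition WW ::
  "real \<Rightarrow> real \<Rightarrow> (real \<Rightarrow> 'v::{real_inner,banach,second_countable_topology} set) \<Rightarrow>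
   (real \<Rightarrow> 'v \<Rightarrow> 'v \<Rightarrow> real) \<Rightarrow> real measure \<Rightarrow> (real \<Rightarrow> 'v) set" where
  "WW s1 s2 W ip \<rho> = {v \<in> H1 s1 s2.
     (AE t in \<rho>. v t \<in> W t) \<and>
     (AE t in lborel. t \<in> {s1<..<s2} \<longrightarrow> weak_deriv s1 s2 v t \<in> W t) \<and>
     (\<integral>\<^sup>+t. (enorm_at W ip t (v t))\<^sup>2 \<partial>\<rho>) +
     (\<integral>\<^sup>+t\<in>{s1<..<s2}. (enorm_at W ip t (weak_deriv s1 s2 v t))\<^sup>2 \<partial>lborel) < \<infinity>}"

text \<open>The inner product whose square norm is the sum of the two integrals above.\<close>

definition ip_WW ::
  "real \<Rightarrow> real \<Rightarrow> (real \<Rightarrow> 'v::{real_inner,banach,second_countable_topology} set) \<Rightarrow>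
   (real \<Rightarrow> 'v \<Rightarrow> 'v \<Rightarrow> real) \<Rightarrow> real measure \<Rightarrow> (real \<Rightarrow> 'v) \<Rightarrow> (real \<Rightarrow> 'v) \<Rightarrow> real" where
  "ip_WW s1 s2 W ip \<rho> v w =
     (\<integral>t. dualop W ip t (v t) (w t) \<partial>\<rho>) +
     set_lebesgue_integral lborel {s1<..<s2}
       (\<lambda>t. dualop W ip t (weak_deriv s1 s2 v t) (weak_deriv s1 s2 w t))"

definition reproducing_kernel_WW ::
  "real \<Rightarrow> real \<Rightarrow> ('v::{real_inner,banach,second_countable_topology} \<Rightarrow> real^'d \<Rightarrow> real^'d) \<Rightarrow>
   (real \<Rightarrow> 'v set) \<Rightarrow> (real \<Rightarrow> 'v \<Rightarrow> 'v \<Rightarrow> real) \<Rightarrow> real measure \<Rightarrow>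
   (real \<times> (real^'d) \<Rightarrow> real \<times> (real^'d) \<Rightarrow> real^'d^'d) \<Rightarrow> bool" where
  "reproducing_kernel_WW s1 s2 ev W ip \<rho> K \<longleftrightarrow>
     (\<forall>l0\<in>{s1..s2}. \<forall>x0 a. \<exists>k \<in> WW s1 s2 W ip \<rho>.
        (\<forall>l\<in>{s1..s2}. \<forall>x. ev (k l) x = K (l, x) (l0, x0) *v a) \<and>
        (\<forall>w \<in> WW s1 s2 W ip \<rho>. ip_WW s1 s2 W ip \<rho> k w = a \<bullet> ev (w l0) x0))"

end

theory Submission
  imports Defs
begin

text \<open>
  The kernel section \<open>v\<close> represents evaluation on the multiscale space, so its inner product with
  any element of that space is known.  Fix \<open>l > s1\<close> and \<open>w \<in> W (min l s2)\<close>, and pair \<open>v\<close> with the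
  hat path \<open>u m = max (l - m) 0 *\<^sub>R w\<close>.  At the scales \<open>m \<le> l\<close> the nesting gives \<open>w \<in> W m\<close> with a
  uniformly bounded norm; at the scales \<open>m > l\<close>, where \<open>w\<close> need not lie in \<open>W m\<close>, the path vanishes.
  Its weak derivative is \<open>- w\<close> before \<open>l\<close> and \<open>0\<close> after, hence \<open>u\<close> belongs to the multiscale space
  (\<open>hat_in_WW\<close>) and the inner product with \<open>v\<close> is the left-hand side of the first identity
  (\<open>pairing_with_hat\<close>), while the reproducing property evaluates it to
  \<open>max (l - l0) 0 * (a \<bullet> ev w x0)\<close>.

  The parameter \<open>l\<close> may exceed \<open>s2\<close>: for \<open>w \<in> W s2\<close> the hats for \<open>l = s2 + 1\<close> and \<open>l = s2\<close> differ on
  \<open>{s1..s2}\<close> by the constant path \<open>w\<close>, so the second identity is the difference of the two instances.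

  Three points need work.  The weak derivative is only a chosen representative, so it has to be
  identified almost everywhere with the explicit one (\<open>weak_derivative_unique\<close>); this is the
  fundamental lemma of the calculus of variations, for which smooth functions that converge
  boundedly to indicators of intervals are built from \<open>exp (- 1 / x)\<close>.  Measurability of
  \<open>m \<mapsto> \<langle>h m, k m\<rangle>\<^sub>m\<close> follows from the measurability of the norms by polarization
  (\<open>dualop_measurable\<close>).  Integrability follows from the finiteness of the integrals of the squared
  norms of both paths (\<open>integrable_dualop\<close>).
\<close>

section \<open>Smooth approximation of indicators of intervals\<close>

text \<open>
  Dividing by powers of \<open>x\<close> makes the family closed under differentiation up to linear combinations,
  so smoothness of \<open>exp (- 1 / x)\<close> at the origin needs only one limit, \<open>flat_tendsto_0\<close>.
\<close>

definition flat :: "nat \<Rightarrow> real \<Rightarrow> real" where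
  "flat k x = (if x > 0 then exp (- (1 / x)) / x ^ k else 0)"

lemma flat_tendsto_0: "(flat k \<longlongrightarrow> 0) (at 0)"
proof -
  have "((\<lambda>y::real. y ^ k / exp y) \<longlongrightarrow> 0) at_top"
    by (rule tendsto_power_div_exp_0)
  then have "((\<lambda>x::real. inverse x ^ k / exp (inverse x)) \<longlongrightarrow> 0) (at_right 0)"
    by (rule filterlim_compose[OF _ filterlim_inverse_at_top_right])
  moreover have "\<forall>\<^sub>F x in at_right 0. inverse x ^ k / exp (inverse x) = flat k x"
    using eventually_at_right_less[of 0]
    by eventually_elim (simp add: flat_def exp_minus field_simps)
  ultimately have "(flat k \<longlongrightarrow> 0) (at_right 0)"
    by (rule Lim_transform_eventually)
  moreover have "\<forall>\<^sub>F x in at_left 0. 0 = flat k x"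
    by (auto simp: eventually_at_filter flat_def)
  then have "(flat k \<longlongrightarrow> 0) (at_left 0)"
    by (rule Lim_transform_eventually[OF tendsto_const])
  ultimately show ?thesis
    using filterlim_split_at by blast
qed

lemma has_field_derivative_flat:
  "(flat k has_field_derivative flat (k + 2) x - k * flat (k + 1) x) (at x)"
proof -
  consider "x > 0" | "x < 0" | "x = 0" by linarith
  then show ?thesis
  proof cases
    case 1
    have "((\<lambda>x. x ^ k) has_field_derivative real k * x ^ k / x) (at x)"
      using DERIV_pow[of k x] 1 by (cases k) auto
    moreover have "((\<lambda>x. exp (- (1 / x))) has_field_derivative exp (- (1 / x)) / x\<^sup>2) (at x)"
      using 1 by (auto intro!: derivative_eq_intros simp: power2_eq_square)
    ultimately have "((\<lambda>x. exp (- (1 / x)) / x ^ k) has_field_derivative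
        (exp (- (1 / x)) / x\<^sup>2 * x ^ k - exp (- (1 / x)) * (real k * x ^ k / x)) / (x ^ k * x ^ k)) (at x)"
      using 1 by (intro DERIV_divide) auto
    then have "((\<lambda>x. exp (- (1 / x)) / x ^ k) has_field_derivative
        flat (k + 2) x - k * flat (k + 1) x) (at x)"
      by (rule DERIV_cong) (use 1 in \<open>simp add: flat_def field_simps power2_eq_square\<close>)
    moreover have "\<forall>\<^sub>F y in nhds x. flat k y = exp (- (1 / y)) / y ^ k"
      using eventually_nhds_in_open[of "{0<..}" x] 1
      by (auto elim!: eventually_mono simp: flat_def)
    ultimately show ?thesis
      by (simp add: DERIV_cong_ev)
  next
    case 2
    have "\<forall>\<^sub>F y in nhds x. flat k y = 0"
      using eventually_nhds_in_open[of "{..<0}" x] 2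
      by (auto elim!: eventually_mono simp: flat_def)
    then show ?thesis
      using 2 by (simp add: DERIV_cong_ev flat_def)
  next
    case 3
    have "((\<lambda>y. (flat k y - flat k 0) / (y - 0)) \<longlongrightarrow> 0) (at 0)"
      using flat_tendsto_0[of "Suc k"]
      by (rule Lim_transform_eventually) (auto simp: eventually_at_filter flat_def field_simps)
    then show ?thesis
      using 3 by (simp add: has_field_derivative_iff flat_def)
  qed
qed

text \<open>
  A class of differentiable functions that contains the derivatives of its members consists of smooth
  functions; closing the family under products lets two one-sided cutoffs be combined.
\<close>

inductive_set flat_algebra :: "(real \<Rightarrow> real) set" where
  flat: "(\<lambda>t. flat k (c * t + d)) \<in> flat_algebra"
| const: "(\<lambda>_. c) \<in> flat_algebra"
| add: "f \<in> flat_algebra \<Longrightarrow> g \<in> flat_algebra \<Longrightarrow> (\<lambda>t. f t + g t) \<in> flat_algebra"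
| mult: "f \<in> flat_algebra \<Longrightarrow> g \<in> flat_algebra \<Longrightarrow> (\<lambda>t. f t * g t) \<in> flat_algebra"

lemma flat_algebra_derivative:
  assumes "f \<in> flat_algebra"
  shows "\<exists>g\<in>flat_algebra. \<forall>t. (f has_field_derivative g t) (at t)"
  using assms
proof induction
  case (flat k c d)
  let ?g = "\<lambda>t. (flat (k + 2) (c * t + d) + (- real k) * flat (k + 1) (c * t + d)) * c"
  have "?g \<in> flat_algebra"
    by (intro flat_algebra.intros)
  moreover have "((\<lambda>t. flat k (c * t + d)) has_field_derivative ?g t) (at t)" for t
    by (rule DERIV_chain2[OF has_field_derivative_flat, THEN DERIV_cong])
       (auto intro!: derivative_eq_intros)
  ultimately show ?case
    by (intro bexI[where x = ?g] allI)
next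
  case (const c)
  show ?case
    by (rule bexI[of _ "\<lambda>_. 0"]) (auto intro: flat_algebra.intros)
next
  case (add f g)
  then obtain f' g' where "f' \<in> flat_algebra" "g' \<in> flat_algebra"
    "\<forall>t. (f has_field_derivative f' t) (at t)" "\<forall>t. (g has_field_derivative g' t) (at t)"
    by blast
  then show ?case
    by (intro bexI[of _ "\<lambda>t. f' t + g' t"]) (auto intro: flat_algebra.intros DERIV_add)
next
  case (mult f g)
  then obtain f' g' where "f' \<in> flat_algebra" "g' \<in> flat_algebra"
    "\<forall>t. (f has_field_derivative f' t) (at t)" "\<forall>t. (g has_field_derivative g' t) (at t)"
    by blast
  with mult show ?case
    by (intro bexI[of _ "\<lambda>t. f' t * g t + g' t * f t"])
       (auto intro!: flat_algebra.intros DERIV_mult)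
qed

lemma flat_algebra_deriv_funpow: "f \<in> flat_algebra \<Longrightarrow> (deriv ^^ n) f \<in> flat_algebra"
proof (induction n)
  case (Suc n)
  then obtain g where "g \<in> flat_algebra" "\<forall>t. ((deriv ^^ n) f has_field_derivative g t) (at t)"
    using flat_algebra_derivative by blast
  then have "deriv ((deriv ^^ n) f) = g"
    by (auto intro: DERIV_imp_deriv)
  with \<open>g \<in> flat_algebra\<close> show ?case by simp
qed simp

text \<open>
  The shifts by \<open>- 1\<close> keep the support inside \<open>{a + 1 / r..b - 1 / r}\<close>, a compact
  subset of \<open>{a<..<b}\<close>.  Since
  \<open>exp (- 1 / y)\<close> tends to \<open>1\<close> at infinity, the plateaus converge to the indicator as \<open>r\<close> grows.
\<close>

definition plateau :: "real \<Rightarrow> real \<Rightarrow> real \<Rightarrow> real \<Rightarrow> real" where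
  "plateau a b r t = flat 0 (r * (t - a) - 1) * flat 0 (r * (b - t) - 1)"

lemma plateau_test_function:
  assumes "s1 \<le> a" "b \<le> s2" "r > 0"
  shows "test_function s1 s2 (plateau a b r)"
proof -
  have eq: "plateau a b r = (\<lambda>t. flat 0 (r * t + (- r * a - 1)) * flat 0 ((- r) * t + (r * b - 1)))"
    by (rule ext, unfold plateau_def, intro arg_cong2[where f = times] arg_cong[where f = "flat 0"])
       (simp_all add: algebra_simps)
  have "plateau a b r \<in> flat_algebra"
    unfolding eq by (intro flat_algebra.intros)
  then have "(deriv ^^ n) (plateau a b r) field_differentiable at t" for n t
    using flat_algebra_derivative flat_algebra_deriv_funpow field_differentiable_def by blast
  moreover have "plateau a b r t = 0" if "t \<notin> {a + 1 / r..b - 1 / r}" for t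
    using that \<open>r > 0\<close> by (auto simp: plateau_def flat_def field_simps)
  moreover have "0 < 1 / r"
    using \<open>r > 0\<close> by simp
  then have "s1 < a + 1 / r" "b - 1 / r < s2"
    using assms by linarith+
  ultimately show ?thesis
    unfolding test_function_def by blast
qed

lemma abs_plateau_le_1: "\<bar>plateau a b r t\<bar> \<le> 1"
  by (auto simp: plateau_def flat_def abs_mult intro!: mult_le_one)

lemma flat_shift_tendsto:
  "(\<lambda>n. flat 0 (real n * x - 1)) \<longlonglongrightarrow> indicator {0<..} x"
proof (cases "x > 0")
  case True
  have *: "filterlim (\<lambda>n. real n * x - 1) at_top sequentially"
    using filterlim_tendsto_add_at_top[OF tendsto_const[of "-1"]
        filterlim_at_top_mult_tendsto_pos[OF tendsto_const[of x] True filterlim_real_sequentially]]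
    by (simp add: algebra_simps)
  then have "(\<lambda>n. exp (- (1 / (real n * x - 1)))) \<longlonglongrightarrow> exp (- 0)"
    by (intro tendsto_intros tendsto_divide_0[OF tendsto_const] filterlim_at_top_imp_at_infinity)
  moreover have "\<forall>\<^sub>F n in sequentially. exp (- (1 / (real n * x - 1))) = flat 0 (real n * x - 1)"
    using filterlim_at_top_dense[THEN iffD1, OF *, THEN spec[of _ 0]]
    by eventually_elim (simp add: flat_def)
  ultimately show ?thesis
    using True by (simp add: Lim_transform_eventually)
next
  case False
  then have "real n * x - 1 \<le> 0" for n
    using mult_nonneg_nonpos[of "real n" x] by simp
  then have "flat 0 (real n * x - 1) = 0" for n
    by (smt (verit) flat_def)
  with False show ?thesis by simp
qed

lemma plateau_tendsto:
  "(\<lambda>n. plateau a b (real n) t) \<longlonglongrightarrow> indicator {a<..<b} t"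
  using tendsto_mult[OF flat_shift_tendsto[of "t - a"] flat_shift_tendsto[of "b - t"]]
  by (simp add: plateau_def indicator_def of_bool_def split: if_splits)

section \<open>Uniqueness of weak derivatives\<close>

lemma square_integrable_imp_set_integrable:
  assumes "square_integrable s1 s2 u"
  shows "set_integrable lborel {s1<..<s2} u"
  unfolding set_integrable_def
proof (rule Bochner_Integration.integrable_bound)
  let ?I = "{s1<..<s2} :: real set"
  have "set_integrable lborel ?I (\<lambda>t. 1 :: real)"
    using emeasure_lborel_box_finite[of s1 s2]
    by (simp add: set_integrable_def box_real integrable_indicator_iff)
  then show "integrable lborel (\<lambda>t. indicator ?I t *\<^sub>R (1 + (norm (u t))\<^sup>2))"
    using assms unfolding set_integrable_def square_integrable_def scaleR_add_right
    by (intro Bochner_Integration.integrable_add) auto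
  show "(\<lambda>t. indicator ?I t *\<^sub>R u t) \<in> borel_measurable lborel"
    using assms by (simp add: square_integrable_def set_borel_measurable_def)
  have "r \<le> 1 + r\<^sup>2" if "r \<ge> 0" for r :: real
    using that sum_squares_bound[of r 1] by (simp add: power2_eq_square)
  then show "AE t in lborel. norm (indicator ?I t *\<^sub>R u t) \<le> norm (indicator ?I t *\<^sub>R (1 + (norm (u t))\<^sup>2))"
    by (auto simp: indicator_def)
qed

text \<open>
  The measures with densities \<open>max g 0\<close> and \<open>max (- g) 0\<close> are finite and agree on all half-lines,
  hence coincide, and so do their densities almost everywhere.  The coercion \<open>ennreal\<close> takes the
  positive part.
\<close>

lemma AE_zero_if_tail_integrals_zero:
  fixes g :: "real \<Rightarrow> real"
  assumes g: "integrable lborel g"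
    and 0: "\<And>a. (\<integral>t. indicator {a<..} t * g t \<partial>lborel) = 0"
  shows "AE t in lborel. g t = 0"
proof -
  let ?D = "\<lambda>h. density lborel (\<lambda>t. ennreal (h t))"
  have [measurable]: "g \<in> borel_measurable borel"
    using g by auto
  have tail: "emeasure (?D h) {a<..} = (\<integral>\<^sup>+t. ennreal (indicator {a<..} t * h t) \<partial>lborel)"
    if [measurable]: "h \<in> borel_measurable borel" for h :: "real \<Rightarrow> real" and a
    by (subst emeasure_density) (auto split: split_indicator intro!: nn_integral_cong)
  have fin: "(\<integral>\<^sup>+t. ennreal (indicator {a<..} t * h t) \<partial>lborel) < \<infinity>"
    if h: "integrable lborel h" for h :: "real \<Rightarrow> real" and a
  proof -
    have "integrable lborel (\<lambda>t. indicator {a<..} t * h t)"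
      using integrable_mult_indicator[OF _ h, of "{a<..}"] by simp
    then show ?thesis
      by (auto simp: real_integrable_def less_top)
  qed
  have "?D g = ?D (\<lambda>t. - g t)"
  proof (rule measure_eqI_lessThan)
    fix a
    let ?P = "\<integral>\<^sup>+t. ennreal (indicator {a<..} t * g t) \<partial>lborel"
      and ?N = "\<integral>\<^sup>+t. ennreal (indicator {a<..} t * - g t) \<partial>lborel"
    show "emeasure (?D g) {a<..} < \<infinity>"
      using fin[OF g] by (simp add: tail)
    have "integrable lborel (\<lambda>t. indicator {a<..} t * g t)"
      using integrable_mult_indicator[OF _ g, of "{a<..}"] by simp
    then have "enn2real ?P - enn2real ?N = 0"
      using 0[of a] by (simp add: real_lebesgue_integral_def)
    moreover have "?P < \<infinity>" "?N < \<infinity>"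
      using fin[OF g] fin[of "\<lambda>t. - g t"] g by auto
    ultimately have "?P = ?N"
      by (metis ennreal_enn2real eq_iff_diff_eq_0 infinity_ennreal_def)
    then show "emeasure (?D g) {a<..} = emeasure (?D (\<lambda>t. - g t)) {a<..}"
      by (simp add: tail)
  qed simp_all
  then have "AE t in lborel. ennreal (g t) = ennreal (- g t)"
    by (subst (asm) lborel.sigma_finite_measure_axioms[THEN sigma_finite_measure.density_unique_iff]) auto
  then show ?thesis
    by eventually_elim (metis ennreal_eq_0_iff ennreal_neg linorder_le_cases neg_0_le_iff_le neg_le_0_iff_le order_antisym)
qed

lemma zero_if_orthogonal_to_dense:
  fixes x :: "'v::real_inner"
  assumes "\<And>X. open X \<Longrightarrow> X \<noteq> {} \<Longrightarrow> \<exists>h\<in>D. h \<in> X" and "\<And>h. h \<in> D \<Longrightarrow> x \<bullet> h = 0"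
  shows "x = 0"
proof (rule ccontr)
  assume "x \<noteq> 0"
  then obtain h where "h \<in> D" "dist x h < norm x"
    using assms(1)[of "ball x (norm x)"] by auto
  then have "(norm (x - h))\<^sup>2 < (norm x)\<^sup>2"
    by (simp add: dist_norm power_strict_mono)
  moreover have "(norm (x - h))\<^sup>2 = (norm x)\<^sup>2 + (norm h)\<^sup>2"
    using assms(2)[OF \<open>h \<in> D\<close>] by (simp add: power2_norm_eq_inner inner_diff inner_commute)
  ultimately show False by simp
qed

text \<open>
  Dominated convergence along plateaus turns test functions into indicators of intervals.  The
  vector-valued case reduces to scalars by pairing with a countable dense set of vectors.
\<close>

lemma AE_zero_if_test_integrals_zero:
  fixes G :: "real \<Rightarrow> 'v::{real_inner,banach,second_countable_topology}"
  assumes G: "integrable lborel G" and off: "\<And>t. t \<notin> {s1<..<s2} \<Longrightarrow> G t = 0"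
    and test: "\<And>\<phi>. test_function s1 s2 \<phi> \<Longrightarrow> (\<integral>t. \<phi> t *\<^sub>R G t \<partial>lborel) = 0"
  shows "AE t in lborel. G t = 0"
proof -
  have [measurable]: "G \<in> borel_measurable borel"
    using G by auto
  have tail: "(\<integral>t. indicator {a<..} t *\<^sub>R G t \<partial>lborel) = 0" for a
  proof -
    \<comment> \<open>Only the part of the half-line inside \<open>{s1<..<s2}\<close> matters, and it is an interval that starts at
      \<open>max a s1\<close>; plateaus over it are test functions.\<close>
    define b where "b = max a s1"
    let ?s = "\<lambda>n t. plateau b s2 (real (Suc n)) t *\<^sub>R G t"
    have [measurable]: "plateau b s2 r \<in> borel_measurable borel" for r
      unfolding plateau_def flat_def by measurable
    have "(\<lambda>n. \<integral>t. ?s n t \<partial>lborel) \<longlonglongrightarrow> (\<integral>t. indicator {b<..<s2} t *\<^sub>R G t \<partial>lborel)"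
    proof (rule integral_dominated_convergence)
      show "integrable lborel (\<lambda>t. norm (G t))"
        using G by simp
      show "AE t in lborel. (\<lambda>n. ?s n t) \<longlonglongrightarrow> indicator {b<..<s2} t *\<^sub>R G t"
        using plateau_tendsto by (intro AE_I2 tendsto_scaleR tendsto_const LIMSEQ_Suc)
      show "AE t in lborel. norm (?s n t) \<le> norm (G t)" for n
        using abs_plateau_le_1 by (auto intro!: mult_left_le_one_le)
    qed measurable
    moreover have "(\<integral>t. ?s n t \<partial>lborel) = 0" for n
      by (rule test[OF plateau_test_function]) (auto simp: b_def)
    moreover have "indicator {b<..<s2} t *\<^sub>R G t = indicator {a<..} t *\<^sub>R G t" for t
      using off[of t] by (auto simp: b_def indicator_def)
    ultimately show ?thesis
      by (simp add: LIMSEQ_const_iff)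
  qed
  have "AE t in lborel. G t \<bullet> h = 0" for h
  proof (rule AE_zero_if_tail_integrals_zero)
    show "integrable lborel (\<lambda>t. G t \<bullet> h)"
      using G by simp
    fix a
    have "integrable lborel (\<lambda>t. indicator {a<..} t *\<^sub>R G t)"
      using integrable_mult_indicator[OF _ G, of "{a<..}"] by simp
    then have "(\<integral>t. indicator {a<..} t *\<^sub>R G t \<bullet> h \<partial>lborel) = 0"
      using tail[of a] by (subst integral_inner_left) auto
    then show "(\<integral>t. indicator {a<..} t * (G t \<bullet> h) \<partial>lborel) = 0"
      by simp
  qed
  moreover obtain D :: "'v set" where "countable D"
    and D: "\<And>X. open X \<Longrightarrow> X \<noteq> {} \<Longrightarrow> \<exists>h\<in>D. h \<in> X"
    by (rule countable_dense_setE) blast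
  ultimately have "AE t in lborel. \<forall>h\<in>D. G t \<bullet> h = 0"
    by (simp add: AE_ball_countable)
  then show ?thesis
    by eventually_elim (blast intro: zero_if_orthogonal_to_dense D)
qed

lemma weak_derivative_unique:
  assumes "has_weak_derivative s1 s2 v d" and "has_weak_derivative s1 s2 v d'"
  shows "AE t in lborel. t \<in> {s1<..<s2} \<longrightarrow> d t = d' t"
proof -
  let ?I = "{s1<..<s2} :: real set"
  have int: "integrable lborel (\<lambda>t. indicator ?I t *\<^sub>R d t)" "integrable lborel (\<lambda>t. indicator ?I t *\<^sub>R d' t)"
    using assms square_integrable_imp_set_integrable
    unfolding has_weak_derivative_def set_integrable_def by blast+
  have "AE t in lborel. indicator ?I t *\<^sub>R d t - indicator ?I t *\<^sub>R d' t = 0"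
  proof (rule AE_zero_if_test_integrals_zero)
    show "integrable lborel (\<lambda>t. indicator ?I t *\<^sub>R d t - indicator ?I t *\<^sub>R d' t)"
      using int by simp
    fix \<phi> assume \<phi>: "test_function s1 s2 \<phi>"
    have cont: "continuous_on UNIV \<phi>"
      using \<phi> unfolding test_function_def
      by (metis continuous_at_imp_continuous_on field_differentiable_imp_continuous_at funpow_0)
    then have [measurable]: "\<phi> \<in> borel_measurable borel"
      by (rule borel_measurable_continuous_onI)
    have "compact (\<phi> ` {s1..s2})"
      using cont by (intro compact_continuous_image) (auto intro: continuous_on_subset)
    then obtain B where "\<forall>y\<in>\<phi> ` {s1..s2}. norm y \<le> B"
      using compact_imp_bounded bounded_iff by blast
    then have B: "\<bar>\<phi> t\<bar> \<le> B" if "t \<in> {s1..s2}" for t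
      using that by simp
    have *: "integrable lborel (\<lambda>t. \<phi> t *\<^sub>R indicator ?I t *\<^sub>R e t)"
      if e: "integrable lborel (\<lambda>t. indicator ?I t *\<^sub>R e t)" for e :: "real \<Rightarrow> 'a"
    proof (rule Bochner_Integration.integrable_bound)
      show "integrable lborel (\<lambda>t. B *\<^sub>R indicator ?I t *\<^sub>R e t)"
        using e by (rule integrable_scaleR_right)
      show "(\<lambda>t. \<phi> t *\<^sub>R indicator ?I t *\<^sub>R e t) \<in> borel_measurable lborel"
        using borel_measurable_integrable[OF e] by measurable
      show "AE t in lborel. norm (\<phi> t *\<^sub>R indicator ?I t *\<^sub>R e t) \<le> norm (B *\<^sub>R indicator ?I t *\<^sub>R e t)"
        by (rule AE_I2) (auto simp: indicator_def intro!: mult_right_mono order_trans[OF B])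
    qed
    have "(\<integral>t. \<phi> t *\<^sub>R indicator ?I t *\<^sub>R d t \<partial>lborel) = (\<integral>t. \<phi> t *\<^sub>R indicator ?I t *\<^sub>R d' t \<partial>lborel)"
      using assms \<phi> unfolding has_weak_derivative_def set_lebesgue_integral_def
      by (simp add: mult.commute)
    then show "(\<integral>t. \<phi> t *\<^sub>R (indicator ?I t *\<^sub>R d t - indicator ?I t *\<^sub>R d' t) \<partial>lborel) = 0"
      unfolding scaleR_diff_right using *[OF int(1)] *[OF int(2)] by simp
  qed simp
  then show ?thesis
    by eventually_elim auto
qed

lemma weak_deriv_eq_AE:
  assumes "has_weak_derivative s1 s2 v d"
  shows "AE t in lborel. t \<in> {s1<..<s2} \<longrightarrow> weak_deriv s1 s2 v t = d t"
  using weak_derivative_unique[OF _ assms] someI[of "has_weak_derivative s1 s2 v", OF assms]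
  unfolding weak_deriv_def by blast

lemma has_weak_derivative_cong:
  assumes "\<And>t. t \<in> {s1<..<s2} \<Longrightarrow> v t = v' t"
  shows "has_weak_derivative s1 s2 v = has_weak_derivative s1 s2 v'"
proof -
  have *: "indicator {s1<..<s2} t *\<^sub>R v t = indicator {s1<..<s2} t *\<^sub>R v' t"
    "indicator {s1<..<s2} t *\<^sub>R (norm (v t))\<^sup>2 = indicator {s1<..<s2} t *\<^sub>R (norm (v' t))\<^sup>2"
    "indicator {s1<..<s2} t *\<^sub>R c *\<^sub>R v t = indicator {s1<..<s2} t *\<^sub>R c *\<^sub>R v' t" for t c
    using assms[of t] by (auto simp: indicator_def)
  show ?thesis
    unfolding has_weak_derivative_def square_integrable_def set_borel_measurable_def
      set_integrable_def set_lebesgue_integral_def * ..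
qed

section \<open>The weak derivative of a hat\<close>

text \<open>
  On \<open>{s1..min l s2}\<close> this is integration by parts for \<open>\<phi> t * (l - t)\<close>.  The boundary term vanishes
  at \<open>s1\<close> and at \<open>s2\<close> because of \<open>\<phi>\<close>, and at \<open>l\<close> because of the other factor.
\<close>

lemma hat_integration_by_parts:
  assumes l: "s1 < l" and s: "s1 < s2" and \<phi>: "test_function s1 s2 \<phi>"
  defines "A \<equiv> \<lambda>t. indicator {s1<..<s2} t * (deriv \<phi> t * max (l - t) 0)"
    and "B \<equiv> \<lambda>t. indicator {s1<..<s2} t * (\<phi> t * - indicator {..<l} t)"
  shows "integrable lborel A" "integrable lborel B"
    and "integral\<^sup>L lborel A = - integral\<^sup>L lborel B"
proof -
  have diff: "(deriv ^^ n) \<phi> field_differentiable at t" for n t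
    using \<phi> by (simp add: test_function_def)
  have d\<phi>: "(\<phi> has_real_derivative deriv \<phi> t) (at t)" for t
    using diff[of 0 t] by (simp add: DERIV_deriv_iff_field_differentiable)
  have cont: "continuous_on S \<phi>" "continuous_on S (deriv \<phi>)" for S
    using diff[of 0] diff[of 1]
    by (auto intro!: continuous_at_imp_continuous_on field_differentiable_imp_continuous_at)
  have ends: "\<phi> s1 = 0" "\<phi> s2 = 0"
    using \<phi> by (auto simp: test_function_def)
  have "set_integrable lborel {s1..s2} (\<lambda>t. deriv \<phi> t * max (l - t) 0)"
    unfolding set_integrable_def
    by (intro borel_integrable_compact continuous_intros cont) auto
  then have "set_integrable lborel {s1<..<s2} (\<lambda>t. deriv \<phi> t * max (l - t) 0)"
    by (rule set_integrable_subset) auto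
  then show A: "integrable lborel A"
    by (simp add: set_integrable_def A_def)
  have "set_integrable lborel {s1..s2} (\<lambda>t. - \<phi> t)"
    unfolding set_integrable_def
    by (intro borel_integrable_compact continuous_intros cont) auto
  then have "set_integrable lborel ({s1<..<s2} \<inter> {..<l}) (\<lambda>t. - \<phi> t)"
    by (rule set_integrable_subset) auto
  then show B: "integrable lborel B"
    by (simp add: set_integrable_def B_def indicator_inter_arith mult_ac)
  define b where "b = min l s2"
  have "(\<integral>t. (deriv \<phi> t * (l - t) - \<phi> t) * indicator {s1..b} t \<partial>lborel) = \<phi> b * (l - b) - \<phi> s1 * (l - s1)"
  proof (rule integral_FTC_Icc_real)
    show "((\<lambda>t. \<phi> t * (l - t)) has_real_derivative deriv \<phi> t * (l - t) - \<phi> t) (at t)" for t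
      by (auto intro!: derivative_eq_intros d\<phi>)
    have "isCont \<phi> t" "isCont (deriv \<phi>) t" for t
      using diff[of 0] diff[of 1] by (simp_all add: field_differentiable_imp_continuous_at)
    then show "isCont (\<lambda>t. deriv \<phi> t * (l - t) - \<phi> t) t" for t
      by (intro continuous_intros)
  qed (use l s in \<open>auto simp: b_def\<close>)
  also have "\<dots> = 0"
    using ends by (simp add: b_def min_def)
  also have "(\<integral>t. (deriv \<phi> t * (l - t) - \<phi> t) * indicator {s1..b} t \<partial>lborel) = (\<integral>t. A t + B t \<partial>lborel)"
  proof (rule integral_cong_AE)
    show "AE t in lborel. (deriv \<phi> t * (l - t) - \<phi> t) * indicator {s1..b} t = A t + B t"
      using AE_lborel_singleton[of s1] AE_lborel_singleton[of b]
      by eventually_elim (auto simp: A_def B_def b_def indicator_def)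
    have [measurable]: "\<phi> \<in> borel_measurable borel" "deriv \<phi> \<in> borel_measurable borel"
      by (intro borel_measurable_continuous_onI cont)+
    show "(\<lambda>t. (deriv \<phi> t * (l - t) - \<phi> t) * indicator {s1..b} t) \<in> borel_measurable lborel"
      by measurable
    show "(\<lambda>t. A t + B t) \<in> borel_measurable lborel"
      using A B by measurable
  qed
  finally show "integral\<^sup>L lborel A = - integral\<^sup>L lborel B"
    using A B by simp
qed

lemma square_integrable_bounded:
  assumes [measurable]: "u \<in> borel_measurable borel" and "\<And>t. t \<in> {s1<..<s2} \<Longrightarrow> norm (u t) \<le> B"
  shows "square_integrable s1 s2 u"
  unfolding square_integrable_def set_borel_measurable_def set_integrable_def
proof (intro conjI)
  show "(\<lambda>t. indicator {s1<..<s2} t *\<^sub>R u t) \<in> borel_measurable borel"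
    by measurable
  show "integrable lborel (\<lambda>t. indicator {s1<..<s2} t *\<^sub>R (norm (u t))\<^sup>2)"
  proof (rule integrableI_bounded_set[where A = "{s1<..<s2}" and B = "B\<^sup>2"])
    show "AE t in lborel. t \<in> {s1<..<s2} \<longrightarrow> norm (indicator {s1<..<s2} t *\<^sub>R (norm (u t))\<^sup>2) \<le> B\<^sup>2"
      using assms(2) by (intro AE_I2) (auto intro!: power_mono)
  qed (use emeasure_lborel_box_finite[of s1 s2] in \<open>auto simp: box_real\<close>)
qed

lemma has_weak_derivative_hat:
  fixes w :: "'v::{real_inner,banach,second_countable_topology}"
  assumes "s1 < l" and "s1 < s2"
  shows "has_weak_derivative s1 s2 (\<lambda>t. max (l - t) 0 *\<^sub>R w) (\<lambda>t. - indicator {..<l} t *\<^sub>R w)"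
  unfolding has_weak_derivative_def
proof (intro conjI allI impI)
  show "square_integrable s1 s2 (\<lambda>t. max (l - t) 0 *\<^sub>R w)"
    by (rule square_integrable_bounded[where B = "(l - s1) * norm w"])
       (use assms in \<open>auto intro!: mult_right_mono\<close>)
  show "square_integrable s1 s2 (\<lambda>t. - indicator {..<l} t *\<^sub>R w)"
    by (rule square_integrable_bounded[where B = "norm w"]) (auto simp: indicator_def)
  fix \<phi> assume "test_function s1 s2 \<phi>"
  note parts = hat_integration_by_parts[OF assms this]
  show "(LINT t:{s1<..<s2}|lborel. deriv \<phi> t *\<^sub>R max (l - t) 0 *\<^sub>R w) =
      - (LINT t:{s1<..<s2}|lborel. \<phi> t *\<^sub>R - indicator {..<l} t *\<^sub>R w)"
    using parts(3) integral_scaleR_left[OF parts(1), of w] integral_scaleR_left[OF parts(2), of w]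
    by (simp add: set_lebesgue_integral_def)
qed

section \<open>The scale of Hilbert spaces\<close>

locale multiscale_family =
  fixes s1 s2 :: real
    and ev :: "'v::{real_inner,banach,second_countable_topology} \<Rightarrow> real^'d \<Rightarrow> real^'d"
    and W :: "real \<Rightarrow> 'v set"
    and ip :: "real \<Rightarrow> 'v \<Rightarrow> 'v \<Rightarrow> real"
  assumes s1_less_s2: "s1 < s2"
    and nested: "nested_family s1 s2 ev W ip"
    and norms: "measurable_norms s1 s2 W ip"
begin

lemma rkhs: "m \<in> {s1..s2} \<Longrightarrow> rkhs_on ev (W m) (ip m)"
  using nested by (simp add: nested_family_def scales_def)

lemma subspace_W: "m \<in> {s1..s2} \<Longrightarrow> subspace (W m)"
  using rkhs by (simp add: rkhs_on_def)

lemma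
  assumes "m \<in> {s1..s2}" and "h \<in> W m" and "k \<in> W m"
  shows ip_commute: "ip m h k = ip m k h"
    and ip_add_left: "g \<in> W m \<Longrightarrow> ip m (h + k) g = ip m h g + ip m k g"
    and ip_scaleR_left: "ip m (r *\<^sub>R h) k = r * ip m h k"
    and ip_pos: "h \<noteq> 0 \<Longrightarrow> 0 < ip m h h"
proof -
  have "inner_product_on (W m) (ip m)"
    using rkhs[OF assms(1)] by (simp add: rkhs_on_def)
  note ip = this[unfolded inner_product_on_def]
  show "ip m h k = ip m k h"
    by (rule ip[THEN conjunct1, rule_format]) fact+
  show "ip m (h + k) g = ip m h g + ip m k g" if "g \<in> W m"
    by (rule ip[THEN conjunct2, THEN conjunct1, rule_format]) fact+
  show "ip m (r *\<^sub>R h) k = r * ip m h k"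
    by (rule ip[THEN conjunct2, THEN conjunct2, THEN conjunct1, rule_format]) fact+
  show "0 < ip m h h" if "h \<noteq> 0"
    by (rule ip[THEN conjunct2, THEN conjunct2, THEN conjunct2, rule_format]) fact+
qed

lemma ip_scaleR_right:
  assumes "m \<in> {s1..s2}" and "h \<in> W m" and "k \<in> W m"
  shows "ip m h (r *\<^sub>R k) = r * ip m h k"
  using assms ip_commute ip_scaleR_left subspace_scale[OF subspace_W] by metis

lemma ip_self_nonneg:
  assumes "m \<in> {s1..s2}" and "h \<in> W m"
  shows "0 \<le> ip m h h"
  using ip_pos[OF assms assms(2)] ip_scaleR_left[OF assms assms(2), of 0]
  by (cases "h = 0") auto

lemma ip_self_add_scaleR:
  assumes m: "m \<in> {s1..s2}" and h: "h \<in> W m" and k: "k \<in> W m"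
  shows "ip m (h + r *\<^sub>R k) (h + r *\<^sub>R k) = ip m h h + 2 * r * ip m h k + r\<^sup>2 * ip m k k"
proof -
  have rk: "r *\<^sub>R k \<in> W m" and s: "h + r *\<^sub>R k \<in> W m"
    using subspace_W[OF m] h k by (auto intro: subspace_add subspace_scale)
  have "ip m (h + r *\<^sub>R k) (h + r *\<^sub>R k) = ip m h (h + r *\<^sub>R k) + r * ip m k (h + r *\<^sub>R k)"
    by (simp add: ip_add_left[OF m h rk s] ip_scaleR_left[OF m k s])
  also have "\<dots> = ip m (h + r *\<^sub>R k) h + r * ip m (h + r *\<^sub>R k) k"
    by (simp add: ip_commute[OF m h s] ip_commute[OF m k s])
  also have "\<dots> = ip m h h + 2 * r * ip m h k + r\<^sup>2 * ip m k k"
    by (simp add: ip_add_left[OF m h rk] ip_scaleR_left[OF m k] h k ip_commute[OF m k h]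
        power2_eq_square algebra_simps)
  finally show ?thesis .
qed

lemma ip_norm_scaleR:
  assumes "m \<in> {s1..s2}" and "h \<in> W m"
  shows "ip_norm (ip m) (r *\<^sub>R h) = \<bar>r\<bar> * ip_norm (ip m) h"
  using assms ip_scaleR_left[OF assms, of "r *\<^sub>R h" r] ip_scaleR_right[OF assms(1,2,2), of r]
    subspace_scale[OF subspace_W[OF assms(1)] assms(2)]
  by (simp add: ip_norm_def real_sqrt_mult flip: power2_eq_square mult.assoc)

lemma enorm_at_finite_iff: "enorm_at W ip m h < \<infinity> \<longleftrightarrow> h \<in> W m"
  by (simp add: enorm_at_def)

lemma enorm_at_square:
  assumes "m \<in> {s1..s2}" and "h \<in> W m"
  shows "(enorm_at W ip m h)\<^sup>2 = ennreal (ip m h h)"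
  using assms ip_self_nonneg[OF assms] by (simp add: enorm_at_def ip_norm_def ennreal_power)

lemma enorm_at_scaleR_le:
  assumes m: "m \<in> {s1..s2}" and h: "r \<noteq> 0 \<Longrightarrow> h \<in> W m \<and> ip_norm (ip m) h \<le> B"
    and r: "\<bar>r\<bar> \<le> R" and "0 \<le> B"
  shows "enorm_at W ip m (r *\<^sub>R h) \<le> ennreal (R * B)"
proof (cases "r = 0")
  case True
  have "0 \<in> W m"
    using subspace_W[OF m] by (rule subspace_0)
  with True show ?thesis
    using ip_norm_scaleR[OF m, of 0 0] by (simp add: enorm_at_def)
next
  case False
  then have "r *\<^sub>R h \<in> W m"
    using h subspace_W[OF m] by (auto intro: subspace_scale)
  moreover have "\<bar>r\<bar> * ip_norm (ip m) h \<le> R * B"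
    using False h r \<open>0 \<le> B\<close> ip_self_nonneg[OF m, of h]
    by (intro mult_mono) (auto simp: ip_norm_def)
  ultimately show ?thesis
    using False h by (simp add: enorm_at_def ip_norm_scaleR[OF m] ennreal_leI)
qed

section \<open>Measurability and integrability of the pairings\<close>

text \<open>
  The hypothesis on measurability concerns norms of a single path.  Polarization expresses the inner
  product through norms of sums and differences, and finiteness of the extended norm detects
  membership in \<open>W m\<close>.
\<close>

lemma dualop_polarization:
  assumes m: "m \<in> {s1..s2}"
  shows "dualop W ip m h k =
    (if enorm_at W ip m h < \<infinity> \<and> enorm_at W ip m k < \<infinity>
     then (enn2real ((enorm_at W ip m (h + k))\<^sup>2) - enn2real ((enorm_at W ip m (h - k))\<^sup>2)) / 4
     else 0)"
proof (cases "h \<in> W m \<and> k \<in> W m")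
  case True
  then have "h + k \<in> W m" "h - k \<in> W m"
    using subspace_W[OF m] by (auto intro: subspace_add subspace_diff)
  then show ?thesis
    using True ip_self_add_scaleR[OF m, of h k 1] ip_self_add_scaleR[OF m, of h k "-1"]
      ip_self_nonneg[OF m, of "h + k"] ip_self_nonneg[OF m, of "h - k"]
    by (simp add: enorm_at_finite_iff[unfolded infinity_ennreal_def] enorm_at_square[OF m] dualop_def)
next
  case False
  then show ?thesis
    by (auto simp: enorm_at_finite_iff[unfolded infinity_ennreal_def] dualop_def)
qed

text \<open>
  A form of the Cauchy-Schwarz inequality, from \<open>\<langle>h \<plusminus> k, h \<plusminus> k\<rangle> \<ge> 0\<close>.  In this additive form the
  bound is infinite when \<open>h\<close> or \<open>k\<close> lies outside \<open>W m\<close>, so no case distinction survives, and it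
  integrates to the sum of the integrals of the squared norms.
\<close>

lemma abs_dualop_le:
  assumes m: "m \<in> {s1..s2}"
  shows "ennreal \<bar>dualop W ip m h k\<bar> \<le> (enorm_at W ip m h)\<^sup>2 + (enorm_at W ip m k)\<^sup>2"
proof (cases "h \<in> W m \<and> k \<in> W m")
  case True
  then have "h + k \<in> W m" "h - k \<in> W m"
    using subspace_W[OF m] by (auto intro: subspace_add subspace_diff)
  then have "\<bar>ip m h k\<bar> \<le> ip m h h + ip m k k"
    using True ip_self_add_scaleR[OF m, of h k 1] ip_self_add_scaleR[OF m, of h k "-1"]
      ip_self_nonneg[OF m, of "h + k"] ip_self_nonneg[OF m, of "h - k"]
      ip_self_nonneg[OF m, of h] ip_self_nonneg[OF m, of k]
    by simp
  then show ?thesis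
    using True by (simp add: dualop_def enorm_at_square[OF m] ip_self_nonneg[OF m] ennreal_leI
        flip: ennreal_plus)
next
  case False
  then show ?thesis
    by (auto simp: dualop_def)
qed

lemma dualop_scaleR_right:
  assumes "m \<in> {s1..s2}" and "r \<noteq> 0 \<Longrightarrow> k \<in> W m"
  shows "dualop W ip m h (r *\<^sub>R k) = r * dualop W ip m h k"
proof (cases "r = 0")
  case True
  then show ?thesis
    using subspace_0[OF subspace_W[OF assms(1)]] ip_scaleR_right[OF assms(1), of h 0 0]
    by (simp add: dualop_def)
next
  case False
  then show ?thesis
    using assms subspace_scale[OF subspace_W[OF assms(1)], of k r]
    by (simp add: dualop_def ip_scaleR_right)
qed

lemma dualop_zero: "m \<in> {s1..s2} \<Longrightarrow> dualop W ip m h 0 = 0"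
  using dualop_scaleR_right[of m 0 0 h] by simp

lemma enorm_at_measurable:
  assumes "u \<in> borel_measurable (restrict_space borel {s1..s2})"
  shows "(\<lambda>m. enorm_at W ip m (u m)) \<in> borel_measurable (restrict_space borel {s1..s2})"
  using norms[unfolded measurable_norms_def, rule_format, OF assms] .

lemma dualop_measurable:
  assumes u: "u \<in> borel_measurable (restrict_space borel {s1..s2})"
    and u': "u' \<in> borel_measurable (restrict_space borel {s1..s2})"
  shows "(\<lambda>m. dualop W ip m (u m) (u' m)) \<in> borel_measurable (restrict_space borel {s1..s2})"
proof -
  note [measurable] = u u' enorm_at_measurable[OF u] enorm_at_measurable[OF u']
    enorm_at_measurable[OF borel_measurable_add[OF u u']]
    enorm_at_measurable[OF borel_measurable_diff[OF u u']]
  have "(\<lambda>m. if enorm_at W ip m (u m) < \<infinity> \<and> enorm_at W ip m (u' m) < \<infinity>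
     then (enn2real ((enorm_at W ip m (u m + u' m))\<^sup>2) - enn2real ((enorm_at W ip m (u m - u' m))\<^sup>2)) / 4
     else 0) \<in> borel_measurable (restrict_space borel {s1..s2})"
    by measurable
  then show ?thesis
    by (rule measurable_cong[THEN iffD1, rotated])
       (simp add: space_restrict_space dualop_polarization)
qed

lemma integrable_dualop:
  assumes M: "sets M = sets (restrict_space borel {s1..s2})"
    and u: "u \<in> borel_measurable (restrict_space borel {s1..s2})"
    and u': "u' \<in> borel_measurable (restrict_space borel {s1..s2})"
    and fin: "(\<integral>\<^sup>+m. (enorm_at W ip m (u m))\<^sup>2 \<partial>M) < \<infinity>"
      "(\<integral>\<^sup>+m. (enorm_at W ip m (u' m))\<^sup>2 \<partial>M) < \<infinity>"
  shows "integrable M (\<lambda>m. dualop W ip m (u m) (u' m))"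
proof (rule integrableI_bounded)
  note cong = measurable_cong_sets[OF M refl]
  show "(\<lambda>m. dualop W ip m (u m) (u' m)) \<in> borel_measurable M"
    unfolding cong using dualop_measurable[OF u u'] .
  have [measurable]: "(\<lambda>m. enorm_at W ip m (u m)) \<in> borel_measurable M"
    "(\<lambda>m. enorm_at W ip m (u' m)) \<in> borel_measurable M"
    unfolding cong by (rule enorm_at_measurable, fact u u')+
  have "space M = {s1..s2}"
    using sets_eq_imp_space_eq[OF M] by (simp add: space_restrict_space)
  then have "(\<integral>\<^sup>+m. ennreal (norm (dualop W ip m (u m) (u' m))) \<partial>M) \<le>
      (\<integral>\<^sup>+m. (enorm_at W ip m (u m))\<^sup>2 + (enorm_at W ip m (u' m))\<^sup>2 \<partial>M)"
    by (intro nn_integral_mono) (simp add: abs_dualop_le)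
  also have "\<dots> < \<infinity>"
    using fin by (subst nn_integral_add) auto
  finally show "(\<integral>\<^sup>+m. ennreal (norm (dualop W ip m (u m) (u' m))) \<partial>M) < \<infinity>" .
qed

text \<open>
  A path on the open interval extends by \<open>0\<close> to \<open>{s1..s2}\<close>, where the previous two lemmas apply; the
  end points contribute nothing because \<open>dualop W ip m 0 0 = 0\<close>.
\<close>

lemma
  assumes d: "set_borel_measurable borel {s1<..<s2} d" and d': "set_borel_measurable borel {s1<..<s2} d'"
  shows set_dualop_measurable:
      "set_borel_measurable borel {s1<..<s2} (\<lambda>m. dualop W ip m (d m) (d' m))" (is ?meas)
    and set_integrable_dualop:
      "(\<integral>\<^sup>+m\<in>{s1<..<s2}. (enorm_at W ip m (d m))\<^sup>2 \<partial>lborel) < \<infinity> \<Longrightarrow>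
       (\<integral>\<^sup>+m\<in>{s1<..<s2}. (enorm_at W ip m (d' m))\<^sup>2 \<partial>lborel) < \<infinity> \<Longrightarrow>
       set_integrable lborel {s1<..<s2} (\<lambda>m. dualop W ip m (d m) (d' m))" (is "?fin \<Longrightarrow> ?fin' \<Longrightarrow> ?int")
proof -
  let ?I = "{s1<..<s2}"
  let ?z = "\<lambda>d m. indicator ?I m *\<^sub>R d m"
  let ?f = "\<lambda>m. dualop W ip m (?z d m) (?z d' m)"
  have meas: "?z d \<in> borel_measurable (restrict_space borel {s1..s2})"
    "?z d' \<in> borel_measurable (restrict_space borel {s1..s2})"
    using d d' unfolding set_borel_measurable_def by (auto intro: measurable_restrict_space1)
  have eq: "indicator {s1..s2} m *\<^sub>R ?f m = indicator ?I m *\<^sub>R dualop W ip m (d m) (d' m)" for m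
    by (auto simp: indicator_def dualop_zero)
  show ?meas
    using dualop_measurable[OF meas] unfolding set_borel_measurable_def
    by (subst (asm) borel_measurable_restrict_space_iff) (simp_all only: eq, auto)
  have nn: "(\<integral>\<^sup>+m. (enorm_at W ip m (?z d m))\<^sup>2 \<partial>restrict_space lborel {s1..s2}) =
      (\<integral>\<^sup>+m\<in>?I. (enorm_at W ip m (d m))\<^sup>2 \<partial>lborel)" for d
  proof -
    have "enorm_at W ip m 0 = 0" if "m \<in> {s1..s2}" for m
      using enorm_at_scaleR_le[OF that, of 0 0 0 0] by simp
    then show ?thesis
      by (subst nn_integral_restrict_space)
         (auto intro!: nn_integral_cong simp: indicator_def of_bool_def)
  qed
  show ?int if ?fin ?fin'
  proof -
    have "integrable (restrict_space lborel {s1..s2}) ?f"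
      by (rule integrable_dualop) (use meas that in \<open>simp_all add: nn sets_restrict_space\<close>)
    then have "integrable lborel (\<lambda>m. indicator {s1..s2} m *\<^sub>R ?f m)"
      by (rule integrable_restrict_space[THEN iffD1, rotated]) simp
    then show ?int
      unfolding eq set_integrable_def .
  qed
qed

text \<open>
  The supremum in the operator norm bounds the ratio of the norms after normalization of \<open>h\<close>.  The
  maximum with \<open>1\<close> accounts for \<open>m = l\<close>, which the supremum over \<open>m < l\<close> leaves out.
\<close>

lemma uniformly_bounded_inclusions:
  "\<exists>C\<ge>0. \<forall>l\<in>{s1..s2}. \<forall>m\<in>{s1..l}. \<forall>h\<in>W l. h \<in> W m \<and> ip_norm (ip m) h \<le> C * ip_norm (ip l) h"
proof -
  obtain C where bound: "\<forall>x\<in>{incl_norm W ip l m |l m. l \<in> scales s1 s2 \<and> m \<in> scales s1 s2 \<and> m < l}. x \<le> C"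
    using nested unfolding nested_family_def bdd_above_def by meson
  have C: "incl_norm W ip l m \<le> C" if "l \<in> {s1..s2}" "m \<in> {s1..s2}" "m < l" for l m
    by (rule bound[rule_format], intro CollectI exI[of _ l] exI[of _ m])
       (use that in \<open>simp add: scales_def\<close>)
  have "h \<in> W m \<and> ip_norm (ip m) h \<le> max C 1 * ip_norm (ip l) h"
    if l: "l \<in> {s1..s2}" and m: "m \<in> {s1..l}" and h: "h \<in> W l" for l m h
  proof (cases "m = l")
    case True
    have "1 * ip_norm (ip l) h \<le> max C 1 * ip_norm (ip l) h"
      by (rule mult_right_mono) (auto simp: ip_norm_def ip_self_nonneg[OF l h])
    with True h show ?thesis by simp
  next
    case False
    with l m have "m < l" and m': "m \<in> {s1..s2}" by auto
    then have "cont_inclusion W ip l m"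
      using nested l m' by (simp add: nested_family_def scales_def)
    then obtain c where sub: "W l \<subseteq> W m" and c: "\<And>g. g \<in> W l \<Longrightarrow> ip_norm (ip m) g \<le> c * ip_norm (ip l) g"
      unfolding cont_inclusion_def by blast
    have "ip_norm (ip m) h \<le> max C 1 * ip_norm (ip l) h"
    proof (cases "h = 0")
      case True
      then show ?thesis
        using ip_norm_scaleR[OF l h, of 0] ip_norm_scaleR[OF m' subsetD[OF sub h], of 0] by simp
    next
      case False
      define n where "n = ip_norm (ip l) h"
      have "n > 0"
        using ip_pos[OF l h h False] by (simp add: n_def ip_norm_def)
      let ?S = "{ip_norm (ip m) g |g. g \<in> W l \<and> ip_norm (ip l) g \<le> 1}"
      have "bdd_above ?S"
      proof (rule bdd_aboveI)
        fix x assume "x \<in> ?S"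
        then obtain g where g: "x = ip_norm (ip m) g" "g \<in> W l" "ip_norm (ip l) g \<le> 1" by blast
        have "0 \<le> ip_norm (ip l) g"
          by (simp add: ip_norm_def ip_self_nonneg[OF l g(2)])
        then have "c * ip_norm (ip l) g \<le> \<bar>c\<bar> * 1"
          using g(3) by (intro mult_mono) auto
        then show "x \<le> \<bar>c\<bar>"
          using c[OF g(2)] g(1) by simp
      qed
      moreover have "ip_norm (ip m) ((1 / n) *\<^sub>R h) \<in> ?S"
        using h \<open>n > 0\<close> ip_norm_scaleR[OF l h, of "1 / n"] subspace_scale[OF subspace_W[OF l] h]
        by (intro CollectI exI[of _ "(1 / n) *\<^sub>R h"]) (simp add: n_def)
      ultimately have "ip_norm (ip m) ((1 / n) *\<^sub>R h) \<le> Sup ?S"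
        by (rule cSup_upper[rotated])
      also have "\<dots> \<le> C"
        using C[OF l m' \<open>m < l\<close>] by (simp add: incl_norm_def)
      finally have "ip_norm (ip m) h \<le> C * n"
        using \<open>n > 0\<close> ip_norm_scaleR[OF m' subsetD[OF sub h], of "1 / n"] by (simp add: field_simps)
      also have "\<dots> \<le> max C 1 * n"
        using \<open>n > 0\<close> by (intro mult_right_mono) auto
      finally show ?thesis by (simp add: n_def)
    qed
    with sub h show ?thesis by blast
  qed
  then show ?thesis
    by (intro exI[of _ "max C 1"]) auto
qed

section \<open>Pairing with hats\<close>

lemma hat_direction_bounded:
  assumes "s1 < l" and "w \<in> W (min l s2)"
  shows "\<exists>B\<ge>0. \<forall>m\<in>{s1..s2}. m \<le> l \<longrightarrow> w \<in> W m \<and> ip_norm (ip m) w \<le> B"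
proof -
  obtain C where "C \<ge> 0"
    and C: "\<And>l m h. l \<in> {s1..s2} \<Longrightarrow> m \<in> {s1..l} \<Longrightarrow> h \<in> W l \<Longrightarrow>
      h \<in> W m \<and> ip_norm (ip m) h \<le> C * ip_norm (ip l) h"
    using uniformly_bounded_inclusions by blast
  have b: "min l s2 \<in> {s1..s2}"
    using assms(1) s1_less_s2 by auto
  show ?thesis
  proof (intro exI conjI ballI impI)
    show "0 \<le> C * ip_norm (ip (min l s2)) w"
      using \<open>C \<ge> 0\<close> ip_self_nonneg[OF b assms(2)] by (simp add: ip_norm_def)
    fix m assume "m \<in> {s1..s2}" "m \<le> l"
    then have m: "m \<in> {s1..min l s2}" by simp
    show "w \<in> W m" "ip_norm (ip m) w \<le> C * ip_norm (ip (min l s2)) w"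
      using C[OF b m assms(2)] by blast+
  qed
qed

text \<open>
  Both the hat and its derivative are multiples of \<open>w\<close> with bounded coefficients that vanish where
  \<open>w\<close> may leave \<open>W m\<close>; on the finite measures \<open>\<rho>\<close> and Lebesgue measure on \<open>{s1<..<s2}\<close>, bounded
  norms give finite energy.
\<close>

lemma
  fixes w :: 'v
  assumes \<rho>: "sets \<rho> = sets (restrict_space borel {s1..s2})" "finite_measure \<rho>"
    and l: "s1 < l" and w: "w \<in> W (min l s2)"
  shows hat_energy: "(\<integral>\<^sup>+m. (enorm_at W ip m (max (l - m) 0 *\<^sub>R w))\<^sup>2 \<partial>\<rho>) < \<infinity>"
    and hat_derivative_energy:
      "(\<integral>\<^sup>+m\<in>{s1<..<s2}. (enorm_at W ip m (- indicator {..<l} m *\<^sub>R w))\<^sup>2 \<partial>lborel) < \<infinity>"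
    and hat_in_WW: "(\<lambda>m. max (l - m) 0 *\<^sub>R w) \<in> WW s1 s2 W ip \<rho>"
proof -
  let ?u = "\<lambda>m. max (l - m) 0 *\<^sub>R w" and ?d = "\<lambda>m. - indicator {..<l} m *\<^sub>R w"
  interpret finite_measure \<rho> by fact
  have space: "space \<rho> = {s1..s2}"
    using sets_eq_imp_space_eq[OF \<rho>(1)] by (simp add: space_restrict_space)
  obtain B where "0 \<le> B"
    and B: "\<And>m. m \<in> {s1..s2} \<Longrightarrow> m \<le> l \<Longrightarrow> w \<in> W m \<and> ip_norm (ip m) w \<le> B"
    using hat_direction_bounded[OF l w] by blast
  have u: "enorm_at W ip m (?u m) \<le> ennreal ((l - s1) * B)" if "m \<in> {s1..s2}" for m
    by (rule enorm_at_scaleR_le) (use that B l \<open>0 \<le> B\<close> in auto)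
  have d: "enorm_at W ip m (?d m) \<le> ennreal (1 * B)" if "m \<in> {s1..s2}" for m
    by (rule enorm_at_scaleR_le) (use that B \<open>0 \<le> B\<close> in \<open>auto simp: indicator_def\<close>)
  have "(\<integral>\<^sup>+m. (enorm_at W ip m (?u m))\<^sup>2 \<partial>\<rho>) \<le> (\<integral>\<^sup>+m. (ennreal ((l - s1) * B))\<^sup>2 \<partial>\<rho>)"
    using u by (intro nn_integral_mono power_mono) (auto simp: space)
  also have "\<dots> < \<infinity>"
    by (simp add: less_top[symmetric] ennreal_mult_eq_top_iff power2_eq_square)
  finally show U: "(\<integral>\<^sup>+m. (enorm_at W ip m (?u m))\<^sup>2 \<partial>\<rho>) < \<infinity>" .
  have "(\<integral>\<^sup>+m\<in>{s1<..<s2}. (enorm_at W ip m (?d m))\<^sup>2 \<partial>lborel) \<le>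
      (\<integral>\<^sup>+m\<in>{s1<..<s2}. (ennreal (1 * B))\<^sup>2 \<partial>lborel)"
  proof (rule nn_integral_mono)
    fix m
    show "(enorm_at W ip m (?d m))\<^sup>2 * indicator {s1<..<s2} m \<le> (ennreal (1 * B))\<^sup>2 * indicator {s1<..<s2} m"
      using power_mono[OF d[of m], of 2] by (cases "m \<in> {s1<..<s2}") auto
  qed
  also have "\<dots> < \<infinity>"
    using s1_less_s2 \<open>0 \<le> B\<close> by (simp add: nn_integral_cmult_indicator ennreal_power ennreal_mult_less_top)
  finally show D: "(\<integral>\<^sup>+m\<in>{s1<..<s2}. (enorm_at W ip m (?d m))\<^sup>2 \<partial>lborel) < \<infinity>" .
  have weak: "has_weak_derivative s1 s2 ?u ?d"
    using l s1_less_s2 by (rule has_weak_derivative_hat)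
  have ae: "AE m in lborel. m \<in> {s1<..<s2} \<longrightarrow> weak_deriv s1 s2 ?u m = ?d m"
    using weak by (rule weak_deriv_eq_AE)
  have in_W: "h \<in> W m" if "enorm_at W ip m h \<le> ennreal c" for h m c
    using le_less_trans[OF that] enorm_at_finite_iff[of m h] by simp
  show "?u \<in> WW s1 s2 W ip \<rho>"
    unfolding WW_def H1_def mem_Collect_eq
  proof (intro conjI exI)
    show "continuous_on {s1..s2} ?u"
      by (intro continuous_intros)
    show "has_weak_derivative s1 s2 ?u ?d" by fact
    show "AE m in \<rho>. ?u m \<in> W m"
      by (rule AE_I2) (use u in_W space in blast)
    show "AE m in lborel. m \<in> {s1<..<s2} \<longrightarrow> weak_deriv s1 s2 ?u m \<in> W m"
      using ae
    proof eventually_elim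
      case (elim m)
      then show ?case
        using in_W[OF d[of m]] by auto
    qed
    have "(\<integral>\<^sup>+m\<in>{s1<..<s2}. (enorm_at W ip m (weak_deriv s1 s2 ?u m))\<^sup>2 \<partial>lborel) =
        (\<integral>\<^sup>+m\<in>{s1<..<s2}. (enorm_at W ip m (?d m))\<^sup>2 \<partial>lborel)"
      using ae by (intro nn_integral_cong_AE) (auto elim!: eventually_mono simp: indicator_def)
    with U D show "(\<integral>\<^sup>+m. (enorm_at W ip m (?u m))\<^sup>2 \<partial>\<rho>) +
        (\<integral>\<^sup>+m\<in>{s1<..<s2}. (enorm_at W ip m (weak_deriv s1 s2 ?u m))\<^sup>2 \<partial>lborel) < \<infinity>"
      by simp
  qed
qed

lemma weak_deriv_measurable:
  assumes "u \<in> H1 s1 s2"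
  shows "set_borel_measurable borel {s1<..<s2} (weak_deriv s1 s2 u)"
proof -
  have "has_weak_derivative s1 s2 u (weak_deriv s1 s2 u)"
    using assms someI_ex[of "has_weak_derivative s1 s2 u"] by (simp add: H1_def weak_deriv_def)
  then show ?thesis
    by (simp add: has_weak_derivative_def square_integrable_def)
qed

lemma pairing_with_hat:
  assumes \<rho>: "sets \<rho> = sets (restrict_space borel {s1..s2})" "finite_measure \<rho>"
    and v: "v \<in> WW s1 s2 W ip \<rho>"
    and l: "s1 < l" and w: "w \<in> W (min l s2)"
  shows "set_integrable \<rho> {s1..l} (\<lambda>m. (l - m) * dualop W ip m (v m) w)"
    and "set_integrable lborel {s1<..<min l s2} (\<lambda>m. dualop W ip m (weak_deriv s1 s2 v m) w)"
    and "ip_WW s1 s2 W ip \<rho> v (\<lambda>m. max (l - m) 0 *\<^sub>R w) =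
      set_lebesgue_integral \<rho> {s1..l} (\<lambda>m. (l - m) * dualop W ip m (v m) w) -
      set_lebesgue_integral lborel {s1<..<min l s2} (\<lambda>m. dualop W ip m (weak_deriv s1 s2 v m) w)"
proof -
  let ?I = "{s1<..<s2}" and ?J = "{s1<..<min l s2}"
  let ?u = "\<lambda>m. max (l - m) 0 *\<^sub>R w" and ?d = "\<lambda>m. - indicator {..<l} m *\<^sub>R w"
  let ?dv = "weak_deriv s1 s2 v" and ?du = "weak_deriv s1 s2 ?u"
  have space: "space \<rho> = {s1..s2}"
    using sets_eq_imp_space_eq[OF \<rho>(1)] by (simp add: space_restrict_space)
  have mem: "w \<in> W m" if "m \<in> {s1..s2}" "m \<le> l" for m
    using hat_direction_bounded[OF l w] that by blast
  have u: "?u \<in> WW s1 s2 W ip \<rho>"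
    by (rule hat_in_WW) fact+
  have vH: "v \<in> H1 s1 s2" and uH: "?u \<in> H1 s1 s2"
    using u v by (auto simp: WW_def)
  have fin: "(\<integral>\<^sup>+m. (enorm_at W ip m (v m))\<^sup>2 \<partial>\<rho>) < \<infinity>"
    "(\<integral>\<^sup>+m\<in>?I. (enorm_at W ip m (?dv m))\<^sup>2 \<partial>lborel) < \<infinity>"
    using v by (auto simp: WW_def)
  have cont: "continuous_on {s1..s2} v"
    using vH by (simp add: H1_def)
  have "integrable \<rho> (\<lambda>m. dualop W ip m (v m) (?u m))"
  proof (rule integrable_dualop[OF \<rho>(1)])
    show "v \<in> borel_measurable (restrict_space borel {s1..s2})"
      using cont by (rule borel_measurable_continuous_on_restrict)
    show "?u \<in> borel_measurable (restrict_space borel {s1..s2})"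
      by (intro borel_measurable_continuous_on_restrict continuous_intros)
  qed (use fin hat_energy[OF \<rho> l w] in auto)
  moreover have val: "dualop W ip m (v m) (?u m) = indicator {s1..l} m *\<^sub>R ((l - m) * dualop W ip m (v m) w)"
    if "m \<in> space \<rho>" for m
    using that mem[of m] by (subst dualop_scaleR_right) (auto simp: space indicator_def)
  ultimately show "set_integrable \<rho> {s1..l} (\<lambda>m. (l - m) * dualop W ip m (v m) w)"
    unfolding set_integrable_def by (subst (asm) Bochner_Integration.integrable_cong[OF refl val])
  have first: "(\<integral>m. dualop W ip m (v m) (?u m) \<partial>\<rho>) =
      set_lebesgue_integral \<rho> {s1..l} (\<lambda>m. (l - m) * dualop W ip m (v m) w)"
    unfolding set_lebesgue_integral_def by (rule Bochner_Integration.integral_cong[OF refl val])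
  have d_meas: "set_borel_measurable borel ?I ?d"
    unfolding set_borel_measurable_def by measurable
  have val': "indicator ?I m *\<^sub>R dualop W ip m (?dv m) (?d m) =
      - (indicator ?J m *\<^sub>R dualop W ip m (?dv m) w)" for m
  proof (cases "m \<in> ?I")
    case True
    then show ?thesis
      using mem[of m] by (subst dualop_scaleR_right) (auto simp: indicator_def)
  qed auto
  have "set_integrable lborel ?I (\<lambda>m. dualop W ip m (?dv m) (?d m))"
    using weak_deriv_measurable[OF vH] d_meas fin(2) hat_derivative_energy[OF \<rho> l w]
    by (rule set_integrable_dualop)
  then show "set_integrable lborel ?J (\<lambda>m. dualop W ip m (?dv m) w)"
    unfolding set_integrable_def val' by simp
  have "(LINT m:?I|lborel. dualop W ip m (?dv m) (?du m)) = (LINT m:?I|lborel. dualop W ip m (?dv m) (?d m))"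
    unfolding set_lebesgue_integral_def
  proof (rule integral_cong_AE)
    have "has_weak_derivative s1 s2 ?u ?d"
      using l s1_less_s2 by (rule has_weak_derivative_hat)
    from weak_deriv_eq_AE[OF this]
    show "AE m in lborel. indicator ?I m *\<^sub>R dualop W ip m (?dv m) (?du m) =
        indicator ?I m *\<^sub>R dualop W ip m (?dv m) (?d m)"
      by eventually_elim (auto simp: indicator_def)
  qed (use set_dualop_measurable[OF weak_deriv_measurable[OF vH] weak_deriv_measurable[OF uH]]
        set_dualop_measurable[OF weak_deriv_measurable[OF vH] d_meas]
      in \<open>simp_all add: set_borel_measurable_def\<close>)
  also have "\<dots> = - (LINT m:?J|lborel. dualop W ip m (?dv m) w)"
    unfolding set_lebesgue_integral_def val' by simp
  finally show "ip_WW s1 s2 W ip \<rho> v ?u =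
      set_lebesgue_integral \<rho> {s1..l} (\<lambda>m. (l - m) * dualop W ip m (v m) w) -
      (LINT m:?J|lborel. dualop W ip m (?dv m) w)"
    by (simp add: ip_WW_def first)
qed

text \<open>
  The kernel determines its sections only on \<open>{s1..s2}\<close>, so everything has to depend on the values
  there alone; this includes the choice of the representative \<open>weak_deriv\<close>, since the predicate it
  is chosen from is the same.
\<close>

lemma WW_cong:
  assumes \<rho>: "sets \<rho> = sets (restrict_space borel {s1..s2})"
    and eq: "\<forall>t\<in>{s1..s2}. v t = v' t"
  shows "v \<in> WW s1 s2 W ip \<rho> \<longleftrightarrow> v' \<in> WW s1 s2 W ip \<rho>"
    and "ip_WW s1 s2 W ip \<rho> v u = ip_WW s1 s2 W ip \<rho> v' u"
proof -
  have space: "space \<rho> = {s1..s2}"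
    using sets_eq_imp_space_eq[OF \<rho>] by (simp add: space_restrict_space)
  have weak: "has_weak_derivative s1 s2 v = has_weak_derivative s1 s2 v'"
    by (rule has_weak_derivative_cong) (simp add: eq)
  then have wd: "weak_deriv s1 s2 v = weak_deriv s1 s2 v'"
    by (simp add: weak_deriv_def)
  have "continuous_on {s1..s2} v = continuous_on {s1..s2} v'"
    by (rule continuous_on_cong) (simp_all add: eq)
  moreover have "(AE t in \<rho>. v t \<in> W t) = (AE t in \<rho>. v' t \<in> W t)"
    by (rule AE_cong) (simp add: space eq)
  moreover have "(\<integral>\<^sup>+t. (enorm_at W ip t (v t))\<^sup>2 \<partial>\<rho>) = (\<integral>\<^sup>+t. (enorm_at W ip t (v' t))\<^sup>2 \<partial>\<rho>)"
    by (rule nn_integral_cong) (simp add: space eq)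
  ultimately show "v \<in> WW s1 s2 W ip \<rho> \<longleftrightarrow> v' \<in> WW s1 s2 W ip \<rho>"
    by (simp add: WW_def H1_def weak wd)
  have "(\<integral>t. dualop W ip t (v t) (u t) \<partial>\<rho>) = (\<integral>t. dualop W ip t (v' t) (u t) \<partial>\<rho>)"
    by (rule Bochner_Integration.integral_cong) (simp_all add: space eq)
  then show "ip_WW s1 s2 W ip \<rho> v u = ip_WW s1 s2 W ip \<rho> v' u"
    by (simp add: ip_WW_def wd)
qed

end

section \<open>The identities for the kernel\<close>

theorem mainTheorem2:
  fixes s1 s2 :: real
    and ev :: "'v::{real_inner,banach,second_countable_topology} \<Rightarrow> real^'d \<Rightarrow> real^'d"
    and W :: "real \<Rightarrow> 'v set"
    and ip :: "real \<Rightarrow> 'v \<Rightarrow> 'v \<Rightarrow> real"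
    and \<rho> :: "real measure"
    and K :: "real \<times> (real^'d) \<Rightarrow> real \<times> (real^'d) \<Rightarrow> real^'d^'d"
    and l0 :: real and x0 a :: "real^'d"
    and v :: "real \<Rightarrow> 'v"
  assumes "0 < s1" and "s1 < s2"
    and "field_space ev" and "cont_embedded_C1_0 ev"
    and "nested_family s1 s2 ev W ip"
    and "measurable_norms s1 s2 W ip"
    and "sets \<rho> = sets (restrict_space borel {s1..s2})"
    and "finite_measure \<rho>" and "emeasure \<rho> {s1..s2} \<noteq> 0"
    and "reproducing_kernel_WW s1 s2 ev W ip \<rho> K"
    and "l0 \<in> {s1..s2}"
    and "\<forall>l\<in>{s1..s2}. \<forall>x. ev (v l) x = K (l, x) (l0, x0) *v a"
  shows "(\<forall>l\<in>{s1<..s2}. \<forall>w \<in> W l.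
           set_integrable \<rho> {s1..l} (\<lambda>m. (l - m) * dualop W ip m (v m) w) \<and>
           set_integrable lborel {s1<..<l} (\<lambda>m. dualop W ip m (weak_deriv s1 s2 v m) w) \<and>
           set_lebesgue_integral \<rho> {s1..l} (\<lambda>m. (l - m) * dualop W ip m (v m) w)
           - set_lebesgue_integral lborel {s1<..<l} (\<lambda>m. dualop W ip m (weak_deriv s1 s2 v m) w)
           = (l - l0) * indicator {s1..l} l0 * (a \<bullet> ev w x0)) \<and>
         (\<forall>w \<in> W s2.
           integrable \<rho> (\<lambda>m. dualop W ip m (v m) w) \<and>
           (\<integral>m. dualop W ip m (v m) w \<partial>\<rho>) = a \<bullet> ev w x0)"
proof -
  interpret multiscale_family s1 s2 ev W ip
    by unfold_locales fact+
  note \<rho> = assms(7,8)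
  have lin: "linear (\<lambda>h. ev h x)" for x
    using assms(3) by (simp add: field_space_def)
  have inj: "inj ev"
    using assms(3) by (simp add: field_space_def)
  obtain k where k: "k \<in> WW s1 s2 W ip \<rho>"
    and kK: "\<And>l x. l \<in> {s1..s2} \<Longrightarrow> ev (k l) x = K (l, x) (l0, x0) *v a"
    and kw: "\<And>u. u \<in> WW s1 s2 W ip \<rho> \<Longrightarrow> ip_WW s1 s2 W ip \<rho> k u = a \<bullet> ev (u l0) x0"
    using assms(10,11) unfolding reproducing_kernel_WW_def by meson
  have kv: "\<forall>t\<in>{s1..s2}. k t = v t"
    using kK assms(12) by (intro ballI injD[OF inj] ext) simp
  have v: "v \<in> WW s1 s2 W ip \<rho>"
    using WW_cong(1)[OF \<rho>(1) kv] k by blast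
  have vw: "ip_WW s1 s2 W ip \<rho> v u = a \<bullet> ev (u l0) x0" if "u \<in> WW s1 s2 W ip \<rho>" for u
    using WW_cong(2)[OF \<rho>(1) kv, of u] kw[OF that] by simp
  let ?r = "\<lambda>l w m. (l - m) * dualop W ip m (v m) w"
    and ?d = "\<lambda>w m. dualop W ip m (weak_deriv s1 s2 v m) w"
  have identity: "set_lebesgue_integral \<rho> {s1..l} (?r l w) - set_lebesgue_integral lborel {s1<..<min l s2} (?d w) =
      max (l - l0) 0 * (a \<bullet> ev w x0)"
    if l: "s1 < l" and w: "w \<in> W (min l s2)" for l w
    using pairing_with_hat(3)[OF \<rho> v l w] vw[OF hat_in_WW[OF \<rho> l w]] linear_scale[OF lin] by simp
  have part1: "set_integrable \<rho> {s1..l} (?r l w) \<and> set_integrable lborel {s1<..<l} (?d w) \<and>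
      set_lebesgue_integral \<rho> {s1..l} (?r l w) - set_lebesgue_integral lborel {s1<..<l} (?d w) =
      (l - l0) * indicator {s1..l} l0 * (a \<bullet> ev w x0)"
    if l: "l \<in> {s1<..s2}" and w: "w \<in> W l" for l w
  proof -
    have l': "s1 < l" "min l s2 = l"
      using l by auto
    moreover have "max (l - l0) 0 = (l - l0) * indicator {s1..l} l0"
      using assms(11) by (auto simp: indicator_def)
    ultimately show ?thesis
      using pairing_with_hat[OF \<rho> v, of l w] identity[of l w] w by simp
  qed
  have part2: "integrable \<rho> (\<lambda>m. dualop W ip m (v m) w) \<and> (\<integral>m. dualop W ip m (v m) w \<partial>\<rho>) = a \<bullet> ev w x0"
    if w: "w \<in> W s2" for w
  proof -
    \<comment> \<open>On \<open>{s1..s2}\<close> the coefficients \<open>s2 + 1 - m\<close> and \<open>s2 - m\<close> differ by \<open>1\<close>.\<close>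
    let ?e = "\<lambda>l m. indicator {s1..l} m *\<^sub>R ?r l w m"
    have "min (s2 + 1) s2 = s2" "min s2 s2 = s2" by auto
    note l = \<open>s1 < s2\<close> less_trans[OF \<open>s1 < s2\<close> less_add_one] and min = this
    have int: "integrable \<rho> (?e (s2 + 1))" "integrable \<rho> (?e s2)"
      using pairing_with_hat(1)[OF \<rho> v, of _ w] l w by (simp_all add: set_integrable_def min)
    have eq: "?e (s2 + 1) m - ?e s2 m = dualop W ip m (v m) w" if "m \<in> space \<rho>" for m
      using that sets_eq_imp_space_eq[OF \<rho>(1)]
      by (auto simp: space_restrict_space indicator_def algebra_simps)
    have "integrable \<rho> (\<lambda>m. ?e (s2 + 1) m - ?e s2 m)"
      using int by (rule Bochner_Integration.integrable_diff)
    then have D: "integrable \<rho> (\<lambda>m. dualop W ip m (v m) w)"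
      by (subst (asm) Bochner_Integration.integrable_cong[OF refl eq])
    have "(\<integral>m. dualop W ip m (v m) w \<partial>\<rho>) = (\<integral>m. ?e (s2 + 1) m - ?e s2 m \<partial>\<rho>)"
      by (rule Bochner_Integration.integral_cong) (simp_all only: eq)
    also have "\<dots> = max (s2 + 1 - l0) 0 * (a \<bullet> ev w x0) - max (s2 - l0) 0 * (a \<bullet> ev w x0)"
      using identity[of "s2 + 1" w] identity[of s2 w] int l w
      by (simp add: set_lebesgue_integral_def min)
    also have "\<dots> = a \<bullet> ev w x0"
      using assms(11) by (simp add: max_def algebra_simps)
    finally show ?thesis using D by simp
  qed
  show ?thesis
    using part1 part2 by blast
qed

end
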